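(* Let $n\ge2$ and let $\{\mathcal{G}_N\}$ be a family of weighted directed graphs of increasing size $N$ such that, for a fixed index $\bar l\in\{2,3,\dots,N\}$ (not depending on $N$), 1. $\mathrm{Re}\{\lambda_{\bar l}(\mathcal{G}_N)\}\to0$ as $N\to\infty$, and 2. for each $N$ and at least one $l\in\{2,3,\dots,\bar l\}$ it holds that $\arg\{\lambda_l(\mathcal{G}_N)\}>\psi$, where $\psi\in(0,\pi/2)$ is a constant angle independent of $N$. Then no control of the form $$u_i=-\sum_{k=0}^{n-1}a_k\sum_{j\in\mathcal{N}_i}w_{ij}\,(x_i^{(k)}-x_j^{(k)}),\qquad i=1,\dots,N,$$ with gains $a_k>0$, $k=0,\dots,n-1$, that are finite and fixed (independent of $N$ and of the graph within the family), is scalably stable in $\{\mathcal{G}_N\}$. That is, for every such choice of gains there is a graph in the family over which the closed-loop system does not achieve consensus.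
   Context: Graphs: $\mathcal{G}_N=\{\mathcal{V}_N,\mathcal{E}_N\}$ has $N=|\mathcal{V}_N|$ nodes and directed edges; each edge $(i,j)$ carries a nonnegative weight $w_{ij}$ ($w_{ij}=0$ if $(i,j)\notin\mathcal{E}_N$). The neighbor set is $\mathcal{N}_i=\{j:(i,j)\in\mathcal{E}_N\}$. A graph family $\{\mathcal{G}_N\}$ is a sequence of graphs in which $N$ is increasing (to infinity); $\mathcal{G}_N$ need not be a subgraph of $\mathcal{G}_{N+1}$. Laplacian: $[L]_{ij}=-w_{ij}$ if $j\ne i$ and $j\in\mathcal{N}_i$, $[L]_{ii}=\sum_{k\in\mathcal{N}_i}w_{ik}$, and $0$ otherwise. Zero is assumed to be a simple eigenvalue, and the eigenvalues $\lambda_l(\mathcal{G}_N)$, counted with multiplicity, are numbered so that $0=\lambda_1(\mathcal{G}_N)<\mathrm{Re}\{\lambda_2(\mathcal{G}_N)\}\le\dots\le\mathrm{Re}\{\lambda_N(\mathcal{G}_N)\}$. The argument $\arg$ takes values in $(-\pi,\pi]$. Dynamics: each agent $i$ has a scalar state $x_i(t)\in\mathbb{R}$ obeying $\frac{d}{dt}x_i^{(k)}=x_i^{(k+1)}$ for $k=0,\dots,n-2$ and $\frac{d}{dt}x_i^{(n-1)}=u_i$, where $x_i^{(k)}$ is the $k$-th time derivative of $x_i$. Consensus and scalable stability: the closed-loop system achieves consensus if $x_i^{(k)}(t)-x_j^{(k)}(t)\to0$ as $t\to\infty$ for all $i,j\in\mathcal{V}_N$, all $k=0,\dots,n-1$,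 and any initial state. A control design is scalably stable in $\{\mathcal{G}_N\}$ if the resulting closed-loop system achieves consensus over every graph in the family. *)

theory Defs
  imports
    "HOL-Analysis.Analysis"
    "Jordan_Normal_Form.Char_Poly"
    "Graph_Theory.Pair_Digraph"
begin

text \<open>
  Nodes are numbered from 0, so that they index rows and columns of matrices directly.
  \<^term>\<open>pair_digraph\<close> excludes self-loops: these would cancel in the dynamics but would
  change the diagonal of the Laplacian.
\<close>

definition weighted_digraph :: "nat \<Rightarrow> nat pair_pre_digraph \<Rightarrow> (nat \<Rightarrow> nat \<Rightarrow> real) \<Rightarrow> bool" where
  "weighted_digraph N D w \<longleftrightarrow>
     pair_digraph D \<and> pverts D = {0..<N} \<and>
     (\<forall>i j. 0 \<le> w i j) \<and> (\<forall>i j. (i, j) \<notin> parcs D \<longrightarrow> w i j = 0)"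

definition nbrs :: "nat pair_pre_digraph \<Rightarrow> nat \<Rightarrow> nat set" where
  "nbrs D i = {j. (i, j) \<in> parcs D}"

definition laplacian :: "nat \<Rightarrow> nat pair_pre_digraph \<Rightarrow> (nat \<Rightarrow> nat \<Rightarrow> real) \<Rightarrow> real mat" where
  "laplacian N D w = mat N N (\<lambda>(i, j).
     if i = j then (\<Sum>k\<in>nbrs D i. w i k)
     else if j \<in> nbrs D i then - w i j
     else 0)"

text \<open>
  \<open>lam 1, \<dots>, lam N\<close> lists the eigenvalues with algebraic multiplicity. Such a list need not be
  unique, since eigenvalues with equal real parts may be interchanged. The strict inequality
  makes 0 a simple eigenvalue.
\<close>

definition laplacian_eigenvalues ::
  "nat \<Rightarrow> nat pair_pre_digraph \<Rightarrow> (nat \<Rightarrow> nat \<Rightarrow> real) \<Rightarrow> (nat \<Rightarrow> complex) \<Rightarrow> bool" where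
  "laplacian_eigenvalues N D w lam \<longleftrightarrow>
     image_mset lam (mset_set {1..N}) =
       proots (char_poly (map_mat complex_of_real (laplacian N D w))) \<and>
     lam 1 = 0 \<and>
     (\<forall>l\<in>{2..N}. 0 < Re (lam l)) \<and>
     (\<forall>l m. 2 \<le> l \<and> l \<le> m \<and> m \<le> N \<longrightarrow> Re (lam l) \<le> Re (lam m))"

text \<open>
  A family is a sequence of graphs; its \<open>m\<close>-th member has \<open>N m\<close> nodes.
\<close>

definition graph_family ::
  "(nat \<Rightarrow> nat) \<Rightarrow> (nat \<Rightarrow> nat pair_pre_digraph) \<Rightarrow> (nat \<Rightarrow> nat \<Rightarrow> nat \<Rightarrow> real) \<Rightarrow> bool" where
  "graph_family N D w \<longleftrightarrow> strict_mono N \<and> (\<forall>m. weighted_digraph (N m) (D m) (w m))"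

text \<open>
  In a state \<open>z\<close>, the value \<open>z i k\<close> is the \<open>k\<close>-th derivative (\<open>k < n\<close>) of the scalar state of
  agent \<open>i\<close>; a feedback law maps states to agents' inputs.
\<close>

type_synonym state = "nat \<Rightarrow> nat \<Rightarrow> real"

definition closed_loop_trajectory ::
  "nat \<Rightarrow> nat set \<Rightarrow> (state \<Rightarrow> nat \<Rightarrow> real) \<Rightarrow> (real \<Rightarrow> state) \<Rightarrow> bool" where
  "closed_loop_trajectory n V u x \<longleftrightarrow>
     (\<forall>t\<ge>0. \<forall>i\<in>V.
        (\<forall>k. k + 1 < n \<longrightarrow>
           ((\<lambda>s. x s i k) has_real_derivative x t i (k + 1)) (at t within {0..})) \<and>
        ((\<lambda>s. x s i (n - 1)) has_real_derivative u (x t) i) (at t within {0..}))"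

text \<open>
  Quantifying over all trajectories amounts to quantifying over all initial states \<open>x 0\<close>.
\<close>

definition achieves_consensus :: "nat \<Rightarrow> nat set \<Rightarrow> (state \<Rightarrow> nat \<Rightarrow> real) \<Rightarrow> bool" where
  "achieves_consensus n V u \<longleftrightarrow>
     (\<forall>x. closed_loop_trajectory n V u x \<longrightarrow>
        (\<forall>i\<in>V. \<forall>j\<in>V. \<forall>k<n. ((\<lambda>t. x t i k - x t j k) \<longlongrightarrow> 0) at_top))"

text \<open>
  A control design assigns a feedback law to every weighted graph.
\<close>

type_synonym control_design =
  "nat pair_pre_digraph \<Rightarrow> (nat \<Rightarrow> nat \<Rightarrow> real) \<Rightarrow> state \<Rightarrow> nat \<Rightarrow> real"

definition relative_feedback :: "nat \<Rightarrow> (nat \<Rightarrow> real) \<Rightarrow> control_design" where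
  "relative_feedback n a D w z i =
     - (\<Sum>k<n. a k * (\<Sum>j\<in>nbrs D i. w i j * (z i k - z j k)))"

definition scalably_stable ::
  "nat \<Rightarrow> control_design \<Rightarrow> (nat \<Rightarrow> nat pair_pre_digraph) \<Rightarrow> (nat \<Rightarrow> nat \<Rightarrow> nat \<Rightarrow> real) \<Rightarrow> bool" where
  "scalably_stable n F D w \<longleftrightarrow>
     (\<forall>m. achieves_consensus n (pverts (D m)) (F (D m) (w m)))"

end

theory Submission
  imports Defs
begin

text \<open>
  A Laplacian eigenvector \<open>v\<close> with eigenvalue \<open>\<mu> \<noteq> 0\<close> spans a mode in which every agent moves
  as a multiple of one scalar signal, and \<open>exp (s t)\<close> is such a signal exactly when \<open>s\<close> is a root of
  \<open>s^n + \<mu> (a_(n-1) s^(n-1) + \<dots> + a_0)\<close>. Since \<open>v\<close> is not constant over the nodes, a root with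
  \<open>Re s \<ge> 0\<close> produces two agents whose distance does not tend to 0. So consensus forces this
  polynomial to be Hurwitz for every nonzero eigenvalue (\<open>consensus_imp_hurwitz_mode\<close>).

  By the Gauss-Lucas theorem for the left half plane (\<open>hurwitz_pderiv\<close>), derivatives of a Hurwitz
  polynomial are Hurwitz until they become constant. The derivative of order \<open>n - 2\<close> of the mode
  polynomial is a positive multiple of \<open>z^2 + \<mu> b z + \<mu> c\<close>, where \<open>b, c > 0\<close> depend on \<open>n\<close> and
  the gains only (\<open>mode_poly_reduce_to_quadratic\<close>). Hence order \<open>n\<close> reduces to order 2.

  By the stability criterion of Hermite, for \<open>Re \<mu> > 0\<close> and \<open>b, c > 0\<close> this quadratic is Hurwitz
  only if \<open>b^2 Re \<mu> |\<mu>|^2 > c (Im \<mu>)^2\<close> (\<open>quadratic_root_right_half_plane\<close>). An argument above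
  \<open>\<psi>\<close> gives \<open>Re \<mu> < cot \<psi> * Im \<mu>\<close>, so the left side is at most
  \<open>b^2 (cot^2 \<psi> + 1) Re \<mu> (Im \<mu>)^2\<close>, and the inequality fails once
  \<open>Re \<mu> \<le> c / (b^2 (cot^2 \<psi> + 1))\<close>. That bound does not involve the graph, so members of the
  family with \<open>Re (lam lbar)\<close> small enough violate it. Only \<open>Re \<mu>\<close> has to be small: the imaginary
  part may stay away from 0 or even grow.
\<close>

section \<open>Hurwitz polynomials and their derivatives\<close>

definition hurwitz :: "complex poly \<Rightarrow> bool" where
  "hurwitz p \<longleftrightarrow> (\<forall>z. poly p z = 0 \<longrightarrow> Re z < 0)"

text \<open>
  The logarithmic derivative is the sum of \<open>1 / (z - r)\<close> over the roots \<open>r\<close>, and each summand has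
  positive real part because \<open>z\<close> lies to the right of \<open>r\<close>. The sum is empty for constants, hence
  the two parts of the conclusion.
\<close>

lemma Re_log_pderiv_hurwitz:
  assumes "hurwitz p" "0 \<le> Re z"
  shows "0 \<le> Re (poly (pderiv p) z / poly p z) \<and>
         (0 < degree p \<longrightarrow> 0 < Re (poly (pderiv p) z / poly p z))"
  using assms(1)
proof (induction "degree p" arbitrary: p)
  case 0
  then obtain c where "p = [:c:]" by (metis degree_eq_zeroE)
  then show ?case by simp
next
  case (Suc d)
  obtain r where r: "poly p r = 0"
    using fundamental_theorem_of_algebra[of p] Suc.hyps(2) constant_degree[of p] by auto
  then obtain q where pq: "p = [:- r, 1:] * q" by (meson dvdE poly_eq_0_iff_dvd)
  have q: "hurwitz q" using Suc.prems by (auto simp: hurwitz_def pq)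
  have "q \<noteq> 0" using Suc.hyps(2) pq by auto
  then have "degree p = Suc (degree q)" unfolding pq by (subst degree_mult_eq) auto
  then have IH: "0 \<le> Re (poly (pderiv q) z / poly q z)" using Suc.hyps q by auto
  have "Re r < 0" using Suc.prems r by (auto simp: hurwitz_def)
  then have pos: "0 < Re (1 / (z - r))" using assms(2) by (subst Re_complex_div_gt_0) auto
  have "poly q z \<noteq> 0" using q assms(2) by (force simp: hurwitz_def)
  moreover have "z \<noteq> r" using \<open>Re r < 0\<close> assms(2) by auto
  ultimately have "poly (pderiv p) z / poly p z = 1 / (z - r) + poly (pderiv q) z / poly q z"
    unfolding pq pderiv_mult by (simp add: pderiv_pCons field_simps)
  then have "Re (poly (pderiv p) z / poly p z) > 0" using IH pos by simp
  then show ?case by simp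
qed

lemma hurwitz_pderiv:
  assumes "hurwitz p" "0 < degree p"
  shows "hurwitz (pderiv p)"
  unfolding hurwitz_def
proof (intro allI impI)
  fix z assume "poly (pderiv p) z = 0"
  then show "Re z < 0" using Re_log_pderiv_hurwitz[OF assms(1), of z] assms(2) by force
qed

lemma hurwitz_higher_pderiv:
  assumes "hurwitz p" "m \<le> degree p"
  shows "hurwitz ((pderiv ^^ m) p)" "degree ((pderiv ^^ m) p) = degree p - m"
proof -
  have "hurwitz ((pderiv ^^ m) p) \<and> degree ((pderiv ^^ m) p) = degree p - m"
    using assms(2)
    by (induction m) (use assms(1) in \<open>auto intro: hurwitz_pderiv simp: degree_pderiv\<close>)
  then show "hurwitz ((pderiv ^^ m) p)" "degree ((pderiv ^^ m) p) = degree p - m" by auto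
qed

section \<open>Hermite's criterion for a quadratic\<close>

text \<open>
  If both roots \<open>s, r\<close> had negative real part, then
  \<open>Re s * Re r * ((Re s + Re r)^2 + (Im s - Im r)^2)\<close> would be positive. Up to a constant factor
  this is the resultant of the real and imaginary parts of the quadratic on the imaginary axis, so
  Vieta's formulas turn it into an expression in the coefficients.
\<close>

lemma quadratic_root_right_half_plane:
  fixes \<mu> :: complex and b c :: real
  assumes "0 < c" and unst: "b\<^sup>2 * Re \<mu> * ((Re \<mu>)\<^sup>2 + (Im \<mu>)\<^sup>2) \<le> c * (Im \<mu>)\<^sup>2"
  shows "\<exists>z. 0 \<le> Re z \<and> z\<^sup>2 + \<mu> * of_real b * z + \<mu> * of_real c = 0"
proof (rule ccontr)
  assume "\<not> ?thesis"
  then have stab: "Re z < 0" if "z\<^sup>2 + \<mu> * of_real b * z + \<mu> * of_real c = 0" for z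
    using that by (meson not_le)
  have "\<not> constant (poly [:\<mu> * of_real c, \<mu> * of_real b, 1:])"
    by (simp add: constant_degree)
  then obtain s where "poly [:\<mu> * of_real c, \<mu> * of_real b, 1:] s = 0"
    using fundamental_theorem_of_algebra by blast
  then have s: "s\<^sup>2 + \<mu> * of_real b * s + \<mu> * of_real c = 0"
    by (simp add: algebra_simps power2_eq_square)
  define r where "r = - \<mu> * of_real b - s"
  have r: "r\<^sup>2 + \<mu> * of_real b * r + \<mu> * of_real c = 0"
    using s unfolding r_def by (simp add: algebra_simps power2_eq_square)
  have sum: "\<mu> * of_real b = - (s + r)" by (simp add: r_def)
  have "\<mu> * of_real c - s * r = s\<^sup>2 + \<mu> * of_real b * s + \<mu> * of_real c"
    unfolding r_def by (simp add: algebra_simps power2_eq_square)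
  then have prod: "\<mu> * of_real c = s * r" using s by simp
  have sb: "Re \<mu> * b = - (Re s + Re r)" "Im \<mu> * b = - (Im s + Im r)"
    using arg_cong[OF sum, of Re] arg_cong[OF sum, of Im] by auto
  have pc: "Re \<mu> * c = Re s * Re r - Im s * Im r" "Im \<mu> * c = Re s * Im r + Im s * Re r"
    using arg_cong[OF prod, of Re] arg_cong[OF prod, of Im] by auto
  have "c * (b\<^sup>2 * Re \<mu> * ((Re \<mu>)\<^sup>2 + (Im \<mu>)\<^sup>2) - c * (Im \<mu>)\<^sup>2) =
        (Re \<mu> * b)\<^sup>2 * (Re \<mu> * c) + (Re \<mu> * b) * (Im \<mu> * b) * (Im \<mu> * c) - (Im \<mu> * c)\<^sup>2"
    by (simp add: algebra_simps power2_eq_square)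
  also have "\<dots> = Re s * Re r * ((Re s + Re r)\<^sup>2 + (Im s - Im r)\<^sup>2)"
    unfolding sb pc by (simp add: algebra_simps power2_eq_square)
  also have "\<dots> > 0"
  proof -
    have "Re s < 0" "Re r < 0" using stab s r by auto
    then show ?thesis
      by (intro mult_pos_pos mult_neg_neg add_pos_nonneg) auto
  qed
  finally have "0 < b\<^sup>2 * Re \<mu> * ((Re \<mu>)\<^sup>2 + (Im \<mu>)\<^sup>2) - c * (Im \<mu>)\<^sup>2"
    using \<open>0 < c\<close> by (simp add: zero_less_mult_iff)
  then show False using unst by simp
qed

section \<open>The characteristic polynomial of a mode\<close>

definition mode_poly :: "nat \<Rightarrow> (nat \<Rightarrow> real) \<Rightarrow> complex \<Rightarrow> complex poly" where
  "mode_poly n a \<mu> = monom 1 n + Polynomial.smult \<mu> (\<Sum>k<n. monom (of_real (a k)) k)"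

lemma poly_mode_poly:
  "poly (mode_poly n a \<mu>) s = s ^ n + \<mu> * (\<Sum>k<n. of_real (a k) * s ^ k)"
  by (simp add: mode_poly_def poly_monom poly_sum)

lemma coeff_mode_poly:
  "coeff (mode_poly n a \<mu>) k = (if k = n then 1 else if k < n then \<mu> * of_real (a k) else 0)"
  by (auto simp: mode_poly_def coeff_sum)

lemma degree_mode_poly: "degree (mode_poly n a \<mu>) = n"
  by (rule antisym[OF degree_le le_degree]) (auto simp: coeff_mode_poly)

text \<open>
  Differentiating \<open>n - 2\<close> times keeps the three top coefficients and multiplies them by positive
  integers, so the shape of the polynomial survives: leading coefficient positive, the others
  positive multiples of \<open>\<mu>\<close>. The quantifier order is essential, as one pair \<open>b, c\<close> has to serve
  the eigenvalues of all graphs in a family.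
\<close>

lemma mode_poly_reduce_to_quadratic:
  fixes a :: "nat \<Rightarrow> real"
  assumes "n \<ge> 2" and "\<forall>k<n. 0 < a k"
  obtains b c :: real where "0 < b" "0 < c"
    "\<And>\<mu> z. hurwitz (mode_poly n a \<mu>) \<Longrightarrow>
       z\<^sup>2 + \<mu> * of_real b * z + \<mu> * of_real c = 0 \<Longrightarrow> Re z < 0"
proof -
  \<comment> \<open>the factor that the coefficient of degree \<open>j + (n - 2)\<close> picks up on its way to degree \<open>j\<close>\<close>
  define f where "f j = real (pochhammer (Suc j) (n - 2))" for j
  have f: "0 < f j" for j by (simp add: f_def pochhammer_pos)
  define b c where "b = f 1 * a (n - 1) / f 2" and "c = f 0 * a (n - 2) / f 2"
  show thesis
  proof
    show "0 < b" "0 < c" using f assms by (simp_all add: b_def c_def)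
  next
    fix \<mu> z
    assume hur: "hurwitz (mode_poly n a \<mu>)"
      and z: "z\<^sup>2 + \<mu> * of_real b * z + \<mu> * of_real c = 0"
    define r where "r = (pderiv ^^ (n - 2)) (mode_poly n a \<mu>)"
    have r: "hurwitz r" "degree r = 2"
      using hurwitz_higher_pderiv[OF hur, of "n - 2"] assms(1)
      by (simp_all add: r_def degree_mode_poly)
    have coeff_r: "coeff r j = of_real (f j) * coeff (mode_poly n a \<mu>) (j + (n - 2))" for j
      unfolding r_def coeff_higher_pderiv f_def by (simp only: pochhammer_of_nat of_real_of_nat_eq)
    have "poly r z = coeff r 0 + coeff r 1 * z + coeff r 2 * z\<^sup>2"
      by (simp add: poly_altdef r(2) numeral_2_eq_2)
    also have "\<dots> = of_real (f 0) * (\<mu> * of_real (a (n - 2)))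
        + of_real (f 1) * (\<mu> * of_real (a (n - 1))) * z + of_real (f 2) * z\<^sup>2"
    proof -
      obtain k where "n = Suc (Suc k)" using assms(1) by (metis add_2_eq_Suc le_Suc_ex)
      then show ?thesis unfolding coeff_r by (simp add: coeff_mode_poly)
    qed
    also have "\<dots> = of_real (f 2) * (z\<^sup>2 + \<mu> * of_real b * z + \<mu> * of_real c)"
      using f[of 2] by (simp add: b_def c_def field_simps)
    finally have "poly r z = 0" using z by simp
    then show "Re z < 0" using r(1) by (simp add: hurwitz_def)
  qed
qed

section \<open>Consensus and Laplacian modes\<close>

lemma nbrs_subset_nodes:
  assumes "weighted_digraph N D w"
  shows "nbrs D i \<subseteq> {0..<N}"
proof -
  interpret pair_digraph D using assms by (simp add: weighted_digraph_def)
  show ?thesis using assms wellformed by (force simp: nbrs_def weighted_digraph_def)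
qed

lemma laplacian_mult_vec:
  assumes "weighted_digraph N D w" "v \<in> carrier_vec N" "i < N"
  shows "vec_index (map_mat complex_of_real (laplacian N D w) *\<^sub>v v) i =
         (\<Sum>j\<in>nbrs D i. of_real (w i j) * (vec_index v i - vec_index v j))"
proof -
  interpret pair_digraph D using assms(1) by (simp add: weighted_digraph_def)
  have loop: "i \<notin> nbrs D i" using no_loops by (force simp: nbrs_def)
  note sub = nbrs_subset_nodes[OF assms(1), of i]
  have fin: "finite (nbrs D i)" using sub finite_subset by blast
  have "vec_index (map_mat complex_of_real (laplacian N D w) *\<^sub>v v) i =
      (\<Sum>j\<in>{0..<N}. of_real (index_mat (laplacian N D w) (i, j)) * vec_index v j)"
    using assms(2,3) by (simp add: laplacian_def scalar_prod_def)
  also have "\<dots> = (\<Sum>j\<in>{0..<N}. (if j = i then of_real (\<Sum>k\<in>nbrs D i. w i k) * vec_index v i else 0)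
      - (if j \<in> nbrs D i then of_real (w i j) * vec_index v j else 0))"
    using assms(3) loop by (intro sum.cong) (auto simp: laplacian_def)
  also have "\<dots> = of_real (\<Sum>k\<in>nbrs D i. w i k) * vec_index v i
      - (\<Sum>j\<in>nbrs D i. of_real (w i j) * vec_index v j)"
    using assms(3) sub
    by (simp add: sum_subtractf sum.If_cases Int_absorb1 Int_commute Int_absorb2)
  also have "\<dots> = (\<Sum>j\<in>nbrs D i. of_real (w i j) * (vec_index v i - vec_index v j))"
    by (simp add: sum_distrib_right right_diff_distrib sum_subtractf)
  finally show ?thesis .
qed

text \<open>
  Along a mode the coupling of the agents acts as multiplication by the eigenvalue, so the closed
  loop reduces to one scalar equation. The free factor \<open>c\<close> makes both the real part (\<open>c = 1\<close>) and
  the imaginary part (\<open>c = - \<i>\<close>) of the complex solution available as real trajectories.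
\<close>

lemma laplacian_mode_trajectory:
  fixes c s \<mu> :: complex
  assumes G: "weighted_digraph N D w" and "0 < n"
    and v: "v \<in> carrier_vec N"
    and eig: "map_mat complex_of_real (laplacian N D w) *\<^sub>v v = \<mu> \<cdot>\<^sub>v v"
    and root: "poly (mode_poly n a \<mu>) s = 0"
  shows "closed_loop_trajectory n (pverts D) (relative_feedback n a D w)
           (\<lambda>t i k. Re (exp (t *\<^sub>R s) * (s ^ k * vec_index v i * c)))"
    (is "closed_loop_trajectory n _ _ ?x")
  unfolding closed_loop_trajectory_def
proof (intro allI ballI impI conjI)
  fix t :: real and i assume i: "i \<in> pverts D"
  then have iN: "i < N" using G by (simp add: weighted_digraph_def)
  have D: "((\<lambda>t. ?x t i k) has_real_derivative
      Re (exp (t *\<^sub>R s) * (s ^ Suc k * vec_index v i * c))) (at t within {0..})" for k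
  proof -
    have "((\<lambda>t. exp (t *\<^sub>R s) * (s ^ k * vec_index v i * c)) has_vector_derivative
        exp (t *\<^sub>R s) * s * (s ^ k * vec_index v i * c)) (at t within {0..})"
      by (intro has_vector_derivative_mult_left exp_scaleR_has_vector_derivative_right)
    from bounded_linear.has_vector_derivative[OF bounded_linear_Re this]
    show ?thesis by (simp add: has_real_derivative_iff_has_vector_derivative mult_ac)
  qed
  have lap: "\<mu> * vec_index v i =
      (\<Sum>j\<in>nbrs D i. of_real (w i j) * (vec_index v i - vec_index v j))"
    using laplacian_mult_vec[OF G v iN] eig v iN by simp
  have "relative_feedback n a D w (?x t) i =
      Re (- (\<Sum>k<n. of_real (a k) * (\<Sum>j\<in>nbrs D i. of_real (w i j) *
        (exp (t *\<^sub>R s) * (s ^ k * vec_index v i * c) - exp (t *\<^sub>R s) * (s ^ k * vec_index v j * c)))))"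
    by (simp add: relative_feedback_def)
  also have "(\<Sum>k<n. of_real (a k) * (\<Sum>j\<in>nbrs D i. of_real (w i j) *
        (exp (t *\<^sub>R s) * (s ^ k * vec_index v i * c) - exp (t *\<^sub>R s) * (s ^ k * vec_index v j * c))))
     = (\<Sum>k<n. of_real (a k) * (exp (t *\<^sub>R s) * s ^ k * c * 
         (\<Sum>j\<in>nbrs D i. of_real (w i j) * (vec_index v i - vec_index v j))))"
    by (simp add: sum_distrib_left algebra_simps)
  also have "\<dots> = exp (t *\<^sub>R s) * c * vec_index v i * (\<mu> * (\<Sum>k<n. of_real (a k) * s ^ k))"
    unfolding lap[symmetric] by (simp add: sum_distrib_left sum_distrib_right algebra_simps)
  also have "\<mu> * (\<Sum>k<n. of_real (a k) * s ^ k) = - (s ^ n)"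
    using root by (simp add: poly_mode_poly add_eq_0_iff)
  finally have u: "relative_feedback n a D w (?x t) i = Re (exp (t *\<^sub>R s) * (s ^ n * vec_index v i * c))"
    by (simp add: mult_ac)
  show "((\<lambda>t. ?x t i k) has_real_derivative ?x t i (k + 1)) (at t within {0..})" for k
    using D[of k] by simp
  show "((\<lambda>t. ?x t i (n - 1)) has_real_derivative relative_feedback n a D w (?x t) i) (at t within {0..})"
    using D[of "n - 1"] \<open>0 < n\<close> unfolding u by simp
qed

text \<open>
  The eigenvector takes different values at some two nodes, since the Laplacian annihilates
  constant vectors. Their distance in the mode has complex modulus \<open>exp (t Re s)\<close> times a positive
  constant; taking real and imaginary parts together excludes that the decay of one of them is an
  accident of oscillation.
\<close>

lemma consensus_imp_hurwitz_mode:
  fixes \<mu> :: complex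
  assumes G: "weighted_digraph N D w" and "0 < n"
    and cons: "achieves_consensus n (pverts D) (relative_feedback n a D w)"
    and ev: "eigenvalue (map_mat complex_of_real (laplacian N D w)) \<mu>" and "\<mu> \<noteq> 0"
  shows "hurwitz (mode_poly n a \<mu>)"
  unfolding hurwitz_def
proof (intro allI impI)
  fix s assume root: "poly (mode_poly n a \<mu>) s = 0"
  obtain v where v: "v \<in> carrier_vec N" "v \<noteq> 0\<^sub>v N"
      and eig: "map_mat complex_of_real (laplacian N D w) *\<^sub>v v = \<mu> \<cdot>\<^sub>v v"
    using ev by (auto simp: eigenvalue_def eigenvector_def laplacian_def)
  have verts: "pverts D = {0..<N}" using G by (simp add: weighted_digraph_def)
  have "\<exists>i<N. \<exists>j<N. vec_index v i \<noteq> vec_index v j"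
  proof (rule ccontr)
    assume "\<not> ?thesis"
    then have same: "vec_index v i = vec_index v j" if "i < N" "j < N" for i j
      using that by blast
    have "vec_index v i = 0" if i: "i < N" for i
    proof -
      have "(\<Sum>j\<in>nbrs D i. of_real (w i j) * (vec_index v i - vec_index v j)) = (0::complex)"
        using same[OF i] nbrs_subset_nodes[OF G, of i] by (intro sum.neutral) force
      then have "\<mu> * vec_index v i = 0"
        using laplacian_mult_vec[OF G v(1) i] eig v(1) i by simp
      then show ?thesis using \<open>\<mu> \<noteq> 0\<close> by simp
    qed
    then have "v = 0\<^sub>v N" using v(1) by auto
    then show False using v(2) by simp
  qed
  then obtain i j where ij: "i < N" "j < N" "vec_index v i \<noteq> vec_index v j" by blast
  define d where "d = vec_index v i - vec_index v j"
  have lim: "((\<lambda>t. Re (exp (t *\<^sub>R s) * d * c)) \<longlongrightarrow> 0) at_top" for c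
  proof -
    have "((\<lambda>t. Re (exp (t *\<^sub>R s) * (s ^ 0 * vec_index v i * c))
        - Re (exp (t *\<^sub>R s) * (s ^ 0 * vec_index v j * c))) \<longlongrightarrow> 0) at_top"
      using cons laplacian_mode_trajectory[OF G \<open>0 < n\<close> v(1) eig root, of c] ij \<open>0 < n\<close>
      unfolding achieves_consensus_def verts by fastforce
    then show ?thesis by (simp add: d_def algebra_simps)
  qed
  have "((\<lambda>t. Complex (Re (exp (t *\<^sub>R s) * d)) (Im (exp (t *\<^sub>R s) * d))) \<longlongrightarrow> Complex 0 0) at_top"
    using lim[of 1] lim[of "- \<i>"] by (intro tendsto_Complex) (simp_all add: algebra_simps)
  then have "((\<lambda>t. exp (t *\<^sub>R s) * d) \<longlongrightarrow> 0) at_top"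
    by (simp only: complex_surj flip: zero_complex.code)
  then have "((\<lambda>t. norm (exp (t *\<^sub>R s) * d)) \<longlongrightarrow> 0) at_top"
    by (rule tendsto_norm_zero)
  then have "((\<lambda>t. exp (t * Re s) * norm d) \<longlongrightarrow> 0) at_top"
    by (simp add: norm_mult)
  then have ev: "\<forall>\<^sub>F t in at_top. exp (t * Re s) * norm d < norm d"
    using ij(3) by (intro order_tendstoD) (auto simp: d_def)
  obtain t where t: "t \<ge> 0" "exp (t * Re s) * norm d < norm d"
    using eventually_happens[OF eventually_conj[OF ev eventually_ge_at_top[of 0]]] by auto
  then have "exp (t * Re s) < 1" using ij(3) by (simp add: d_def)
  then show "Re s < 0" using t(1) by (simp add: mult_less_0_iff)
qed

lemma laplacian_eigenvalues_imp_eigenvalue: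
  assumes "laplacian_eigenvalues N D w lam" "l \<in> {1..N}"
  shows "eigenvalue (map_mat complex_of_real (laplacian N D w)) (lam l)"
proof -
  let ?A = "map_mat complex_of_real (laplacian N D w)"
  have A: "?A \<in> carrier_mat N N" by (simp add: laplacian_def)
  have "lam l \<in># image_mset lam (mset_set {1..N})" using assms(2) by simp
  then have "lam l \<in># proots (char_poly ?A)"
    using assms(1) unfolding laplacian_eigenvalues_def by metis
  then have "poly (char_poly ?A) (lam l) = 0"
    by (metis count_eq_zero_iff count_proots order_root proots_0 set_mset_empty empty_iff)
  then show ?thesis using eigenvalue_root_char_poly[OF A] by blast
qed

lemma Re_less_cot_Im:
  assumes "0 < \<psi>" "\<psi> < Arg z" "0 < Re z"
  shows "Re z < cot \<psi> * Im z"
proof -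
  have "\<bar>Arg z\<bar> < pi / 2" using assms(3) Arg_Re_pos by blast
  then have "tan \<psi> < tan (Arg z)" using assms by (intro tan_monotone) auto
  also have "tan (Arg z) = Im z / Re z" using assms(3) by (simp only: arg_conv_arctan tan_arctan)
  finally have "tan \<psi> * Re z < Im z" using assms(3) by (simp add: field_simps)
  moreover have "0 < tan \<psi>" using assms \<open>\<bar>Arg z\<bar> < pi / 2\<close> by (intro tan_gt_zero) auto
  moreover have "cot \<psi> = 1 / tan \<psi>" by (simp add: cot_def tan_def)
  ultimately show ?thesis by (simp add: pos_less_divide_eq mult.commute)
qed

section \<open>Families of graphs\<close>

theorem theorem4p1:
  fixes n lbar :: nat and \<psi> :: real
    and N :: "nat \<Rightarrow> nat"
    and D :: "nat \<Rightarrow> nat pair_pre_digraph"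
    and w :: "nat \<Rightarrow> nat \<Rightarrow> nat \<Rightarrow> real"
    and lam :: "nat \<Rightarrow> nat \<Rightarrow> complex"
  assumes "n \<ge> 2"
    and "graph_family N D w"
    and "\<And>m. laplacian_eigenvalues (N m) (D m) (w m) (lam m)"
    and "\<And>m. lbar \<in> {2..N m}"
    and "(\<lambda>m. Re (lam m lbar)) \<longlonglongrightarrow> 0"
    and "0 < \<psi>" and "\<psi> < pi / 2"
    and "\<And>m. \<exists>l\<in>{2..lbar}. Arg (lam m l) > \<psi>"
  shows "\<not> (\<exists>a :: nat \<Rightarrow> real. (\<forall>k<n. a k > 0) \<and> scalably_stable n (relative_feedback n a) D w)"
proof
  assume "\<exists>a :: nat \<Rightarrow> real. (\<forall>k<n. a k > 0) \<and> scalably_stable n (relative_feedback n a) D w"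
  then obtain a :: "nat \<Rightarrow> real" where a: "\<forall>k<n. a k > 0"
    and stable: "scalably_stable n (relative_feedback n a) D w" by blast
  obtain b c :: real where "0 < b" "0 < c" and quad: "\<And>\<mu> z. hurwitz (mode_poly n a \<mu>) \<Longrightarrow>
       z\<^sup>2 + \<mu> * of_real b * z + \<mu> * of_real c = 0 \<Longrightarrow> Re z < 0"
    using mode_poly_reduce_to_quadratic[OF assms(1) a] by metis
  \<comment> \<open>the quadratic has a root in the closed right half plane once \<open>Re \<mu> * K \<le> c\<close>\<close>
  define K where "K = b\<^sup>2 * ((cot \<psi>)\<^sup>2 + 1)"
  have "0 < K" using \<open>0 < b\<close> by (simp add: K_def add_nonneg_pos)
  then have "\<forall>\<^sub>F m in sequentially. Re (lam m lbar) < c / K"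
    using assms(5) \<open>0 < c\<close> by (intro order_tendstoD) auto
  then obtain m where m: "Re (lam m lbar) < c / K" by (auto dest: eventually_happens)
  obtain l where l: "l \<in> {2..lbar}" and arg: "Arg (lam m l) > \<psi>" using assms(8) by blast
  define \<mu> where "\<mu> = lam m l"
  have lN: "l \<in> {1..N m}" and pos: "0 < Re \<mu>" and "Re \<mu> \<le> Re (lam m lbar)"
    using l assms(3)[of m] assms(4)[of m] by (auto simp: \<mu>_def laplacian_eigenvalues_def)
  then have "Re \<mu> < c / K" using m by simp
  then have "Re \<mu> * K < c" using \<open>0 < K\<close> by (simp add: pos_less_divide_eq)
  have "(Re \<mu>)\<^sup>2 \<le> (cot \<psi> * Im \<mu>)\<^sup>2"
    using Re_less_cot_Im[OF assms(6) arg] pos by (intro power_mono) (auto simp: \<mu>_def)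
  then have "b\<^sup>2 * Re \<mu> * ((Re \<mu>)\<^sup>2 + (Im \<mu>)\<^sup>2) \<le> b\<^sup>2 * Re \<mu> * ((cot \<psi> * Im \<mu>)\<^sup>2 + (Im \<mu>)\<^sup>2)"
    using pos by (intro mult_left_mono) auto
  also have "\<dots> = (Re \<mu> * K) * (Im \<mu>)\<^sup>2" by (simp add: K_def algebra_simps power_mult_distrib)
  also have "\<dots> \<le> c * (Im \<mu>)\<^sup>2" using \<open>Re \<mu> * K < c\<close> by (intro mult_right_mono) auto
  finally obtain z where "0 \<le> Re z" "z\<^sup>2 + \<mu> * of_real b * z + \<mu> * of_real c = 0"
    using quadratic_root_right_half_plane[OF \<open>0 < c\<close>] by blast
  moreover have "hurwitz (mode_poly n a \<mu>)"
  proof (rule consensus_imp_hurwitz_mode)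
    show "weighted_digraph (N m) (D m) (w m)" using assms(2) by (simp add: graph_family_def)
    show "achieves_consensus n (pverts (D m)) (relative_feedback n a (D m) (w m))"
      using stable by (simp add: scalably_stable_def)
    show "eigenvalue (map_mat complex_of_real (laplacian (N m) (D m) (w m))) \<mu>"
      unfolding \<mu>_def by (rule laplacian_eigenvalues_imp_eigenvalue[OF assms(3) lN])
    show "0 < n" "\<mu> \<noteq> 0" using assms(1) pos by auto
  qed
  ultimately show False using quad[of \<mu> z] by force
qed

end
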